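(* Let $a=\{a_n\}_{n\in\mathbb{Z}}$ be a bilateral sequence of complex numbers such that there exists a sequence $c=\{c_n\}_{n\in\mathbb{Z}_+}$ in the class $\mathcal{X}_-$ for which $|a_n|\le e^{c_{|n|}}$ for every $n\in\mathbb{Z}$. Then for any interval $J$ in $\mathbb{T}$, the set $\mathcal{R}_a(J)$ contains at most one element. In particular, the trigonometric series $\sum_{n=-\infty}^{\infty} a_n z^n$ is not universal in $C_p(\mathbb{T})$.
   Context: $\mathbb{T}=\{z\in\mathbb{C}:|z|=1\}$; $\mathbb{Z}_+$ is the set of non-negative integers. An interval in $\mathbb{T}$ is a closed connected subset of $\mathbb{T}$ of positive length (so $\mathbb{T}$ itself is allowed). For a compact metric space $K$, $C(K)$ is the space of continuous complex-valued functions on $K$. Class $\mathcal{X}_-$: a sequence $\{c_n\}_{n\in\mathbb{Z}_+}$ of positive real numbers belongs to $\mathcal{X}_-$ if $\lim_{n\to\infty} n(c_{n+1}-c_n)=+\infty$ and $\sum_{n=0}^\infty \frac{c_n}{n^2+1}<\infty$. For a bilateral complex sequence $a=\{a_n\}_{n\in\mathbb{Z}}$ and $m\in\mathbb{Z}_+$, put $S^a_m(z)=\sum_{k=-m}^m a_k z^k$. For an interval $J$ in $\mathbb{T}$, $\mathcal{R}_a(J)$ is the set of all $g\in C(J)$ for which there is a strictly increasing sequence $\{m_k\}_{k\in\mathbb{Z}_+}$ of positive integers such that $S^a_{m_k}(z)\to g(z)$ as $k\to\infty$ for every $z\in J$. $C_p(\mathbb{T})$ is $C(\mathbb{T})$ with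 the topology of pointwise convergence. The series $\sum_{n=-\infty}^\infty a_nz^n$ is universal in $C_p(\mathbb{T})$ if for every $f\in C(\mathbb{T})$ there is a strictly increasing sequence $\{n_k\}_{k\in\mathbb{Z}_+}$ of positive integers such that $S^a_{n_k}(z)\to f(z)$ as $k\to\infty$ for every $z\in\mathbb{T}$, i.e. if $\mathcal{R}_a(\mathbb{T})=C(\mathbb{T})$. *)

theory Defs
  imports "HOL-Analysis.Analysis"
begin

abbreviation unit_circle :: "complex set" where
  "unit_circle \<equiv> sphere 0 1"

text \<open>Arc length on the unit circle, as the Lebesgue measure of the set of angles in one period.\<close>

definition arc_length :: "complex set \<Rightarrow> real" where
  "arc_length J = measure lborel {t \<in> {0..<2 * pi}. cis t \<in> J}"

definition circle_interval :: "complex set \<Rightarrow> bool" where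
  "circle_interval J \<longleftrightarrow>
     J \<subseteq> unit_circle \<and> closed J \<and> connected J \<and> arc_length J > 0"

text \<open>
  A function on \<open>K\<close> is represented by the total function that agrees with it on \<open>K\<close> and is
  \<open>undefined\<close> outside, so that equality of elements of \<open>C_space K\<close> is equality on \<open>K\<close>.
\<close>

definition C_space :: "complex set \<Rightarrow> (complex \<Rightarrow> complex) set" where
  "C_space K = {g \<in> extensional K. continuous_on K g}"

definition class_X_minus :: "(nat \<Rightarrow> real) set" where
  "class_X_minus = {c. (\<forall>n. c n > 0)
     \<and> filterlim (\<lambda>n. real n * (c (Suc n) - c n)) at_top sequentially
     \<and> summable (\<lambda>n. c n / ((real n)\<^sup>2 + 1))}"

definition trig_partial_sum :: "(int \<Rightarrow> complex) \<Rightarrow> nat \<Rightarrow> complex \<Rightarrow> complex" where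
  "trig_partial_sum a m z = (\<Sum>k = - int m..int m. a k * z powi k)"

definition limit_functions :: "(int \<Rightarrow> complex) \<Rightarrow> complex set \<Rightarrow> (complex \<Rightarrow> complex) set" where
  "limit_functions a J = {g \<in> C_space J.
     \<exists>m :: nat \<Rightarrow> nat. strict_mono m \<and> (\<forall>k. m k > 0) \<and>
       (\<forall>z\<in>J. (\<lambda>k. trig_partial_sum a (m k) z) \<longlonglongrightarrow> g z)}"

definition universal_in_Cp :: "(int \<Rightarrow> complex) \<Rightarrow> bool" where
  "universal_in_Cp a \<longleftrightarrow> (\<forall>f \<in> C_space unit_circle.
     \<exists>n :: nat \<Rightarrow> nat. strict_mono n \<and> (\<forall>k. n k > 0) \<and>
       (\<forall>z\<in>unit_circle. (\<lambda>k. trig_partial_sum a (n k) z) \<longlonglongrightarrow> f z))"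

lemma universal_in_Cp_iff:
  "universal_in_Cp a \<longleftrightarrow> limit_functions a unit_circle = C_space unit_circle"
  unfolding universal_in_Cp_def limit_functions_def by blast

end

theory Submission
  imports Defs "HOL-Probability.Probability"
begin

text \<open>
  Two limit functions \<open>g\<close>, \<open>h\<close> that differ at a point of \<open>J\<close> have nearly constant nonzero
  difference on a small arc around it. By Baire's theorem the two subsequences of partial sums are
  uniformly bounded on a subarc. Since \<open>c\<close> is eventually increasing and \<open>\<Sum> c\<^sub>n / n\<^sup>2 < \<infinity>\<close>, an
  infinite convolution of uniform distributions gives a probability measure \<open>M\<close> supported on that
  subarc whose \<open>n\<close>-th Fourier coefficient has modulus at most \<open>exp (- 2 c\<^sub>n)\<close> for large \<open>n\<close>. By
  dominated convergence \<open>g\<close> and \<open>h\<close> both integrate to the sum of the \<open>a\<^sub>n\<close> times these coefficients,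
  which converges absolutely because \<open>n (c\<^sub>n\<^sub>+\<^sub>1 - c\<^sub>n) \<rightarrow> \<infinity>\<close> makes \<open>\<Sum> exp (- c\<^sub>n)\<close> finite. So
  \<open>\<integral> (g - h) dM = 0\<close>, a contradiction.
\<close>

section \<open>Characteristic functions of infinite convolutions\<close>

text \<open>The uniform distribution on \<open>[-1, 1]\<close> is a witness: its characteristic
  function is \<open>sin t / t\<close>, and the bound comes from evaluating the antiderivative of
  the exponential at both endpoints.\<close>

lemma uniform_distribution_char_bound:
  obtains U where "real_distribution U" "AE x in U. \<bar>x\<bar> \<le> 1"
    "\<And>t. t \<noteq> 0 \<Longrightarrow> cmod (char U t) \<le> 1 / \<bar>t\<bar>"
proof
  define d :: "real \<Rightarrow> real" where "d x = indicator {-1..1} x / 2" for x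
  have [measurable]: "d \<in> borel_measurable borel"
    unfolding d_def by measurable
  have d_nonneg: "d x \<ge> 0" for x
    by (auto simp: d_def)
  define U where "U = density lborel d"
  have sets_U: "sets U = sets borel"
    by (simp add: U_def)
  have "emeasure U (space U) = (\<integral>\<^sup>+x. ennreal (1/2) * indicator {-1..1::real} x \<partial>lborel)"
    by (auto simp: U_def emeasure_density d_def indicator_def intro!: nn_integral_cong)
  also have "\<dots> = ennreal (1/2) * 2"
    by (subst nn_integral_cmult_indicator) auto
  also have "\<dots> = 1"
    by (metis ennreal_1 ennreal_mult'' ennreal_numeral field_sum_of_halves mult.commute mult_2 zero_le_numeral)
  finally have "prob_space U"
    by (rule prob_spaceI)
  then show "real_distribution U"
    by (simp add: real_distribution_def real_distribution_axioms_def sets_U)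
  show "AE x in U. \<bar>x\<bar> \<le> 1"
    unfolding U_def by (subst AE_density) (auto simp: d_def indicator_def)
  fix t :: real assume t: "t \<noteq> 0"
  let ?F = "\<lambda>x. iexp (t * x) / (2 * \<i> * t)"
  have "char U t = (\<integral>x. indicator {-1..1} x *\<^sub>R (iexp (t * x) / 2) \<partial>lborel)"
    unfolding char_def U_def
    by (subst integral_density) (auto simp: d_nonneg d_def scaleR_conv_of_real intro!: Bochner_Integration.integral_cong)
  also have "\<dots> = ?F 1 - ?F (-1)"
  proof (rule integral_FTC_atLeastAtMost)
    show "(?F has_vector_derivative iexp (t * x) / 2) (at x within {-1..1})" for x
      unfolding of_real_mult
      by (rule has_vector_derivative_real_field)
         (use t in \<open>auto intro!: derivative_eq_intros simp: field_simps\<close>)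
  qed (auto intro!: continuous_intros)
  also have "cmod (?F 1 - ?F (-1)) \<le> cmod (?F 1) + cmod (?F (-1))"
    by (rule norm_triangle_ineq4)
  also have "\<dots> = 1 / \<bar>t\<bar>"
    using norm_exp_i_times[of t] norm_exp_i_times[of "-t"] t
    by (simp add: norm_divide norm_mult)
  finally show "cmod (char U t) \<le> 1 / \<bar>t\<bar>" .
qed

text \<open>The law of a random series whose \<open>k\<close>-th block consists of \<open>N k\<close> independent copies of a
  bounded variable, scaled by \<open>\<delta> k\<close>.\<close>

lemma bounded_distribution_infinite_convolution:
  fixes \<delta> :: "nat \<Rightarrow> real" and N :: "nat \<Rightarrow> nat"
  assumes U: "real_distribution U" "AE x in U. \<bar>x\<bar> \<le> 1"
    and \<delta>: "\<And>k. \<delta> k \<ge> 0" "summable (\<lambda>k. N k * \<delta> k)"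
  obtains M where "real_distribution M" "AE x in M. \<bar>x\<bar> \<le> (\<Sum>k. N k * \<delta> k)"
    "\<And>k t. cmod (char M t) \<le> cmod (char U (\<delta> k * t)) ^ N k"
proof -
  interpret U: real_distribution U by fact
  \<comment> \<open>Coordinate \<open>(k, i)\<close> plays the role of the \<open>i\<close>-th copy
    of the variable in block \<open>k\<close>.\<close>
  define P where "P = Pi\<^sub>M (UNIV :: (nat \<times> nat) set) (\<lambda>_. U)"
  interpret P: product_prob_space "\<lambda>_. U" "UNIV :: (nat \<times> nat) set" ..
  have component: "(\<lambda>\<omega>. \<omega> i) \<in> borel_measurable P" for i
    unfolding P_def using measurable_component_singleton[of i UNIV "\<lambda>_. U"]
    by (simp add: measurable_cong_sets[OF refl U.events_eq_borel])
  note [measurable] = component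
  have distr_component: "distr P borel (\<lambda>\<omega>. \<omega> i) = U" for i
    using P.PiM_component[of i] unfolding P_def
    by (metis (no_types, lifting) U.events_eq_borel UNIV_I distr_cong)
  have prob_P: "prob_space P"
    unfolding P_def by (rule P.P.prob_space_axioms)
  interpret P': prob_space P by fact
  define Y where "Y k \<omega> = (\<Sum>i<N k. \<delta> k * \<omega> (k, i))" for k and \<omega> :: "nat \<times> nat \<Rightarrow> real"
  define X where "X \<omega> = (\<Sum>k. Y k \<omega>)" for \<omega>
  have [measurable]: "Y k \<in> borel_measurable P" for k
    unfolding Y_def by measurable
  have [measurable]: "X \<in> borel_measurable P"
    unfolding X_def by measurable
  have "AE \<omega> in P. \<bar>\<omega> i\<bar> \<le> 1" for i
    unfolding P_def by (rule AE_PiM_component) (use U in \<open>auto intro: U.prob_space_axioms\<close>)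
  then have "AE \<omega> in P. \<forall>i. \<bar>\<omega> i\<bar> \<le> 1"
    by (simp add: AE_all_countable)
  then have Y_bound: "AE \<omega> in P. \<forall>k. \<bar>Y k \<omega>\<bar> \<le> N k * \<delta> k"
  proof eventually_elim
    case (elim \<omega>)
    have "\<bar>Y k \<omega>\<bar> \<le> (\<Sum>i<N k. \<delta> k)" for k
      unfolding Y_def using elim \<delta>(1)[of k]
      by (intro order_trans[OF sum_abs] sum_mono) (auto simp: abs_mult mult_left_le)
    then show ?case by simp
  qed
  have "AE \<omega> in P. \<bar>X \<omega>\<bar> \<le> (\<Sum>k. N k * \<delta> k)"
    using Y_bound
  proof eventually_elim
    case (elim \<omega>)
    then have *: "summable (\<lambda>k. \<bar>Y k \<omega>\<bar>)"
      by (intro summable_comparison_test'[OF \<delta>(2)]) auto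
    then have "\<bar>X \<omega>\<bar> \<le> (\<Sum>k. \<bar>Y k \<omega>\<bar>)"
      unfolding X_def by (rule summable_rabs)
    also have "\<dots> \<le> (\<Sum>k. N k * \<delta> k)"
      using elim by (intro suminf_le[OF _ * \<delta>(2)]) auto
    finally show ?case .
  qed
  have limX: "AE \<omega> in P. (\<lambda>n. \<Sum>k<n. Y k \<omega>) \<longlonglongrightarrow> X \<omega>"
    using Y_bound
  proof eventually_elim
    case (elim \<omega>)
    then have "summable (\<lambda>k. Y k \<omega>)"
      by (intro summable_comparison_test'[OF \<delta>(2)]) auto
    then show ?case
      unfolding X_def by (rule summable_LIMSEQ)
  qed
  \<comment> \<open>The joint law of all coordinates is \<open>P\<close> itself, which is the
    product of the marginals \<open>U\<close>; this is independence.\<close>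
  have indep: "P'.indep_vars (\<lambda>_. borel) (\<lambda>i \<omega>. \<omega> i) UNIV"
  proof (subst P'.indep_vars_iff_distr_eq_PiM)
    show "distr P (Pi\<^sub>M UNIV (\<lambda>i. borel)) (\<lambda>x. \<lambda>i\<in>UNIV. x i)
      = Pi\<^sub>M UNIV (\<lambda>i. distr P borel (\<lambda>\<omega>. \<omega> i))"
    proof -
      have "distr P (Pi\<^sub>M UNIV (\<lambda>i. borel)) (\<lambda>x. x) = distr P P (\<lambda>x. x)"
        by (rule distr_cong) (auto simp: P_def intro!: sets_PiM_cong)
      then show ?thesis
        by (simp add: distr_component restrict_UNIV) (simp add: P_def)
    qed
  qed auto
  define J where "J n = (SIGMA k:{..<n}. {..<N k})" for n
  have Y_sum: "(\<Sum>k<n. Y k \<omega>) = (\<Sum>i\<in>J n. \<delta> (fst i) * \<omega> i)" for n \<omega>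
    unfolding Y_def J_def by (subst sum.Sigma) (auto intro!: sum.cong)
  have char_comp: "char (distr P borel (\<lambda>\<omega>. \<delta> (fst i) * \<omega> i)) t = char U (\<delta> (fst i) * t)" for i t
  proof -
    have "char U (\<delta> (fst i) * t) = char (distr P borel (\<lambda>\<omega>. \<omega> i)) (\<delta> (fst i) * t)"
      by (simp only: distr_component)
    then show ?thesis
      by (simp add: char_def integral_distr mult_ac)
  qed
  have char_partial: "char (distr P borel (\<lambda>\<omega>. \<Sum>k<n. Y k \<omega>)) t = (\<Prod>k<n. char U (\<delta> k * t) ^ N k)" for n t
  proof -
    have "P'.indep_vars (\<lambda>_. borel) (\<lambda>i \<omega>. \<delta> (fst i) * \<omega> i) (J n)"
      by (rule P'.indep_vars_compose2[OF P'.indep_vars_subset[OF indep]]) auto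
    from P'.char_distr_sum[OF this] have
      "char (distr P borel (\<lambda>\<omega>. \<Sum>k<n. Y k \<omega>)) t = (\<Prod>i\<in>J n. char U (\<delta> (fst i) * t))"
      by (simp add: Y_sum char_comp)
    also have "\<dots> = (\<Prod>k<n. \<Prod>i<N k. char U (\<delta> k * t))"
      unfolding J_def by (subst prod.Sigma) (auto intro!: prod.cong)
    finally show ?thesis by simp
  qed
  \<comment> \<open>The partial sums converge almost surely and the exponentials have modulus 1, so
    dominated convergence carries the product formula to the limit.\<close>
  have char_lim: "(\<lambda>n. \<Prod>k<n. char U (\<delta> k * t) ^ N k) \<longlonglongrightarrow> char (distr P borel X) t" for t
  proof -
    have "(\<lambda>n. \<integral>\<omega>. iexp (t * (\<Sum>k<n. Y k \<omega>)) \<partial>P) \<longlonglongrightarrow> (\<integral>\<omega>. iexp (t * X \<omega>) \<partial>P)"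
    proof (rule integral_dominated_convergence[where w="\<lambda>_. 1"])
      show "AE \<omega> in P. (\<lambda>n. iexp (t * (\<Sum>k<n. Y k \<omega>))) \<longlonglongrightarrow> iexp (t * X \<omega>)"
        using limX by eventually_elim (intro tendsto_intros)
    qed auto
    then show ?thesis
      unfolding char_partial[symmetric] by (simp add: char_def integral_distr)
  qed
  show thesis
  proof
    show "real_distribution (distr P borel X)"
      by (rule P'.real_distribution_distr) measurable
    show "AE x in distr P borel X. \<bar>x\<bar> \<le> (\<Sum>k. N k * \<delta> k)"
      by (subst AE_distr_iff) (use \<open>AE \<omega> in P. \<bar>X \<omega>\<bar> \<le> _\<close> in auto)
    fix k t
    \<comment> \<open>Once block \<open>k\<close> occurs in the partial product, all other factors
      can be discarded, since a characteristic function has modulus at most 1.\<close>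
    have "eventually (\<lambda>n. cmod (\<Prod>k<n. char U (\<delta> k * t) ^ N k) \<le> cmod (char U (\<delta> k * t)) ^ N k) sequentially"
      using eventually_gt_at_top[of k]
    proof eventually_elim
      case (elim n)
      then have "cmod (\<Prod>k<n. char U (\<delta> k * t) ^ N k)
          = cmod (char U (\<delta> k * t)) ^ N k * (\<Prod>j\<in>{..<n}-{k}. cmod (char U (\<delta> j * t)) ^ N j)"
        by (subst prod.remove[of _ k]) (simp_all add: norm_mult norm_power prod_norm[symmetric])
      also have "\<dots> \<le> cmod (char U (\<delta> k * t)) ^ N k * 1"
        by (intro mult_left_mono prod_le_1) (auto intro!: power_le_one U.cmod_char_le_1)
      finally show ?case by simp
    qed
    then show "cmod (char (distr P borel X) t) \<le> cmod (char U (\<delta> k * t)) ^ N k"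
      by (rule tendsto_upperbound[OF tendsto_norm[OF char_lim]]) simp
  qed
qed

section \<open>Prescribed Fourier decay on a short interval\<close>

text \<open>Cauchy condensation: for large \<open>j\<close> the block
  \<open>[2^(j+1), 2^(j+2))\<close> has \<open>2^(j+1)\<close> terms, each at least
  \<open>w (2^(j+1)) / 4^(j+2)\<close>, so its sum is at least one eighth of the \<open>j\<close>-th
  dyadic term. The dyadic series will control the length of the support of the measure.\<close>

lemma summable_dyadic_of_summable_div_square:
  fixes w :: "nat \<Rightarrow> real"
  assumes nonneg: "\<And>n. 0 \<le> w n" and mono: "\<And>m n. n0 \<le> m \<Longrightarrow> m \<le> n \<Longrightarrow> w m \<le> w n"
    and summable: "summable (\<lambda>n. w n / ((real n)\<^sup>2 + 1))"
  shows "summable (\<lambda>k. w (2 ^ (k + 1)) / 2 ^ k)"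
proof -
  define f where "f n = w n / ((real n)\<^sup>2 + 1)" for n
  define g where "g k = w (2 ^ (k + 1)) / 2 ^ k" for k :: nat
  have f_nonneg: "0 \<le> f n" for n
    by (simp add: f_def nonneg)
  have block: "g j \<le> 8 * sum f {2 ^ (j + 1)..<2 ^ (j + 2)}" if "n0 \<le> j" for j
  proof -
    have "w (2 ^ (j + 1)) / (2 ^ (j + 2))\<^sup>2 \<le> f n" if n: "n \<in> {2 ^ (j + 1)..<2 ^ (j + 2)}" for n
    proof -
      have "n0 \<le> 2 ^ (j + 1)"
        using \<open>n0 \<le> j\<close> less_exp[of "j + 1"] by linarith
      then have 1: "w (2 ^ (j + 1)) \<le> w n"
        using n by (intro mono) auto
      \<comment> \<open>The strict bound \<open>n < 2^(j+2)\<close> absorbs the \<open>+ 1\<close>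
        in the denominator, because \<open>n^2 + 1 \<le> (n + 1)^2\<close>.\<close>
      have "real (n + 1) \<le> real (2 ^ (j + 2))"
        using n by (intro of_nat_mono) auto
      then have "(real n + 1)\<^sup>2 \<le> (2 ^ (j + 2))\<^sup>2"
        by (intro power_mono) auto
      then have 2: "(real n)\<^sup>2 + 1 \<le> (2 ^ (j + 2))\<^sup>2"
        by (simp add: power2_eq_square algebra_simps)
      show ?thesis
        unfolding f_def by (intro frac_le nonneg 1 2) (simp add: add_nonneg_pos)
    qed
    from sum_mono[of "{2 ^ (j + 1)..<2 ^ (j + 2)}" "\<lambda>_. w (2 ^ (j + 1)) / (2 ^ (j + 2))\<^sup>2" f, OF this]
    have "2 ^ (j + 1) * (w (2 ^ (j + 1)) / (2 ^ (j + 2))\<^sup>2) \<le> sum f {2 ^ (j + 1)..<2 ^ (j + 2)}"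
      by simp
    then show ?thesis
      by (simp add: g_def power2_eq_square)
  qed
  have partial: "(\<Sum>k<m. g (k + n0)) \<le> 8 * sum f {2 ^ (n0 + 1)..<2 ^ (m + n0 + 1)}" for m
  proof (induction m)
    case (Suc m)
    have "sum f {2 ^ (n0 + 1)..<2 ^ (Suc m + n0 + 1)}
        = sum f {2 ^ (n0 + 1)..<2 ^ (m + n0 + 1)} + sum f {2 ^ (m + n0 + 1)..<2 ^ (m + n0 + 2)}"
      by (subst sum.atLeastLessThan_concat) (auto intro!: power_increasing)
    then show ?case
      using Suc block[of "m + n0"] by simp
  qed simp
  have "summable (\<lambda>k. g (k + n0))"
  proof (rule summableI_nonneg_bounded)
    show "0 \<le> g (k + n0)" for k
      by (simp add: g_def nonneg)
    have "sum f {2 ^ (n0 + 1)..<2 ^ (m + n0 + 1)} \<le> suminf f" for m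
      by (rule sum_le_suminf) (use summable f_nonneg in \<open>auto simp: f_def[abs_def]\<close>)
    then show "(\<Sum>k<m. g (k + n0)) \<le> 8 * suminf f" for m
      by (intro order_trans[OF partial] mult_left_mono) auto
  qed
  then have "summable g"
    by (simp add: summable_iff_shift)
  then show ?thesis
    by (simp add: g_def[abs_def])
qed

text \<open>On the frequencies in \<open>[2\<^sup>k, 2\<^sup>k\<^sup>+\<^sup>1)\<close> each factor of the \<open>k\<close>-th block is at most \<open>1/e\<close>.\<close>

lemma localized_distribution_char_decay:
  fixes w :: "nat \<Rightarrow> real"
  assumes nonneg: "\<And>n. 0 \<le> w n" and mono: "\<And>m n. n0 \<le> m \<Longrightarrow> m \<le> n \<Longrightarrow> w m \<le> w n"
    and summable: "summable (\<lambda>n. w n / ((real n)\<^sup>2 + 1))" and "\<epsilon> > 0"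
  obtains M n1 where "real_distribution M" "AE x in M. \<bar>x\<bar> \<le> \<epsilon>"
    "\<And>n t. n1 \<le> n \<Longrightarrow> \<bar>t\<bar> = real n \<Longrightarrow> cmod (char M t) \<le> exp (- w n)"
proof -
  \<comment> \<open>By monotonicity \<open>w (2^(k+1))\<close> dominates \<open>w\<close> on the
    \<open>k\<close>-th dyadic block once \<open>k\<close> is large, so \<open>N k\<close> factors
    \<open>1/e\<close> suffice there. The scale \<open>\<delta> k\<close> makes
    \<open>\<delta> k * \<bar>t\<bar>\<close> at least \<open>e\<close> as soon as
    \<open>\<bar>t\<bar> \<ge> 2^k\<close>.\<close>
  define N where "N k = nat \<lceil>w (2 ^ (k + 1))\<rceil>" for k :: nat
  define \<delta> :: "nat \<Rightarrow> real" where "\<delta> k = exp 1 / 2 ^ k" for k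
  have \<delta>_pos: "\<delta> k > 0" for k
    by (simp add: \<delta>_def)
  \<comment> \<open>Rounding up in \<open>N k\<close> costs at most 1 per block, which accounts for
    the geometric term.\<close>
  have "summable (\<lambda>k. exp 1 * (w (2 ^ (k + 1)) / 2 ^ k + (1/2) ^ k))"
    by (intro summable_mult summable_add summable_dyadic_of_summable_div_square[OF nonneg mono summable]
        summable_geometric) auto
  then have summ: "summable (\<lambda>k. N k * \<delta> k)"
  proof (rule summable_comparison_test'[where N=0])
    fix k :: nat
    have "real (N k) \<le> w (2 ^ (k + 1)) + 1"
      unfolding N_def using nonneg[of "2 ^ (k + 1)"] by linarith
    then have "N k * \<delta> k \<le> (w (2 ^ (k + 1)) + 1) * \<delta> k"
      using \<delta>_pos[of k] by (intro mult_right_mono) auto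
    then show "norm (N k * \<delta> k) \<le> exp 1 * (w (2 ^ (k + 1)) / 2 ^ k + (1/2) ^ k)"
      using \<delta>_pos[of k] by (simp add: \<delta>_def field_simps)
  qed
  from suminf_exist_split[OF \<open>\<epsilon> > 0\<close> this] obtain L where
    L: "\<And>K. K \<ge> L \<Longrightarrow> norm (\<Sum>k. N (k + K) * \<delta> (k + K)) < \<epsilon>"
    by blast
  \<comment> \<open>Dropping the first \<open>K\<close> blocks moves the support into
    \<open>[-\<epsilon>, \<epsilon>]\<close> and gives up only the frequencies below
    \<open>2^K\<close>. Since \<open>2^K > n0\<close>, the remaining frequencies lie where
    \<open>w\<close> is monotone.\<close>
  define K where "K = max L n0"
  obtain U where U: "real_distribution U" "AE x in U. \<bar>x\<bar> \<le> 1"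
    "\<And>t. t \<noteq> 0 \<Longrightarrow> cmod (char U t) \<le> 1 / \<bar>t\<bar>"
    using uniform_distribution_char_bound by blast
  obtain M where M: "real_distribution M" "AE x in M. \<bar>x\<bar> \<le> (\<Sum>k. N (k + K) * \<delta> (k + K))"
    "\<And>k t. cmod (char M t) \<le> cmod (char U (\<delta> (k + K) * t)) ^ N (k + K)"
    using bounded_distribution_infinite_convolution[OF U(1,2) less_imp_le[OF \<delta>_pos]
          summable_ignore_initial_segment[OF summ, of K]] by blast
  show thesis
  proof
    show "real_distribution M" by fact
    show "AE x in M. \<bar>x\<bar> \<le> \<epsilon>"
      using M(2) L[of K] by (auto simp: K_def elim!: eventually_mono)
    fix n :: nat and t :: real
    assume n: "2 ^ K \<le> n" and t: "\<bar>t\<bar> = real n"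
    have "1 \<le> n"
      using n by (metis one_le_numeral one_le_power order_trans)
    then obtain j where j: "2 ^ j \<le> n" "n < 2 ^ (j + 1)"
      using ex_power_ivl1[of 2 n] by auto
    have "K \<le> j"
    proof -
      have "(2::nat) ^ K < 2 ^ (j + 1)"
        using n j by linarith
      then show ?thesis
        by (subst (asm) power_strict_increasing_iff) auto
    qed
    have "n0 \<le> n"
      using n less_exp[of K] max.cobounded2[of n0 L] unfolding K_def by linarith
    have "exp 1 \<le> \<delta> j * \<bar>t\<bar>"
    proof -
      have "(2::real) ^ j \<le> real n"
        using j(1) by (metis of_nat_le_iff of_nat_numeral of_nat_power)
      then show ?thesis
        by (simp add: \<delta>_def t field_simps)
    qed
    then have "1 / \<bar>\<delta> j * t\<bar> \<le> 1 / exp 1"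
      using \<delta>_pos[of j] \<open>1 \<le> n\<close> t by (intro divide_left_mono) (auto simp: abs_mult zero_less_mult_iff)
    moreover have "\<delta> j * t \<noteq> 0"
      using \<delta>_pos[of j] \<open>1 \<le> n\<close> t by auto
    ultimately have "cmod (char U (\<delta> j * t)) \<le> exp (-1)"
      using U(3)[of "\<delta> j * t"] by (simp add: exp_minus inverse_eq_divide)
    then have "cmod (char U (\<delta> j * t)) ^ N j \<le> exp (-1) ^ N j"
      by (intro power_mono) auto
    also have "\<dots> = exp (- real (N j))"
      by (simp add: exp_of_nat_mult[symmetric])
    also have "\<dots> \<le> exp (- w n)"
    proof -
      have "w n \<le> w (2 ^ (j + 1))"
        using j \<open>n0 \<le> n\<close> by (intro mono) auto
      also have "\<dots> \<le> real (N j)"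
        unfolding N_def by linarith
      finally show ?thesis by simp
    qed
    \<comment> \<open>After the shift by \<open>K\<close>, the block of scale
      \<open>\<delta> j\<close> is number \<open>j - K\<close> in the construction of
      \<open>M\<close>.\<close>
    finally show "cmod (char M t) \<le> exp (- w n)"
      using M(3)[of t "j - K"] \<open>K \<le> j\<close> by simp
  qed
qed

section \<open>Baire category on a real interval\<close>

lemma nondegenerate_subinterval_near:
  fixes \<alpha> \<beta> x e :: real
  assumes "\<alpha> < \<beta>" "x \<in> {\<alpha>..\<beta>}" "e > 0"
  obtains p q where "p < q" "{p..q} \<subseteq> {\<alpha>..\<beta>} \<inter> ball x e"
proof
  show "max \<alpha> (x - e / 2) < min \<beta> (x + e / 2)"
    using assms by auto
  show "{max \<alpha> (x - e / 2)..min \<beta> (x + e / 2)} \<subseteq> {\<alpha>..\<beta>} \<inter> ball x e"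
    using \<open>e > 0\<close> by (auto simp: dist_real_def abs_if)
qed

text \<open>The closed sets \<open>F n\<close> on which all \<open>f k\<close> are bounded by
  \<open>n\<close> cover the interval. If each had dense complement, the empty intersection of the
  complements would be dense by Baire; so some \<open>F n\<close> contains a relative neighbourhood
  of a point.\<close>

lemma pointwise_bounded_imp_bounded_on_subinterval:
  fixes f :: "nat \<Rightarrow> real \<Rightarrow> 'a :: real_normed_vector"
  assumes "\<alpha> < \<beta>" and cont: "\<And>k. continuous_on {\<alpha>..\<beta>} (f k)"
    and bdd: "\<And>t. t \<in> {\<alpha>..\<beta>} \<Longrightarrow> Bseq (\<lambda>k. f k t)"
  obtains p q B where "p < q" "{p..q} \<subseteq> {\<alpha>..\<beta>}" "\<And>k t. t \<in> {p..q} \<Longrightarrow> norm (f k t) \<le> B"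
proof -
  define S where "S = {\<alpha>..\<beta>}"
  define F where "F n = {t \<in> S. \<forall>k. norm (f k t) \<le> real n}" for n :: nat
  have closed_F: "closed (F n)" for n
  proof -
    have "F n = S \<inter> (\<Inter>k. {t \<in> S. norm (f k t) \<le> real n})"
      by (auto simp: F_def)
    moreover have "closed {t \<in> S. norm (f k t) \<le> real n}" for k
      unfolding S_def
      by (intro continuous_on_closed_Collect_le continuous_intros cont closed_atLeastAtMost)
    ultimately show ?thesis
      by (auto simp: S_def intro!: closed_Int closed_INT)
  qed
  have cover: "\<exists>n. t \<in> F n" if "t \<in> S" for t
  proof -
    obtain K where "\<And>k. norm (f k t) \<le> K"
      using bdd[of t] \<open>t \<in> S\<close> by (auto simp: S_def Bseq_def)
    then have "norm (f k t) \<le> real (nat \<lceil>K\<rceil>)" for k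
      by (meson order_trans real_nat_ceiling_ge)
    then show ?thesis
      using \<open>t \<in> S\<close> by (auto simp: F_def)
  qed
  have "\<exists>n. \<not> S \<subseteq> closure (S - F n)"
  proof (rule ccontr)
    assume *: "\<nexists>n. \<not> S \<subseteq> closure (S - F n)"
    have "S \<subseteq> closure (\<Inter>(range (\<lambda>n. S - F n)))"
    proof (rule Baire)
      show "closed S" "countable (range (\<lambda>n. S - F n))"
        by (auto simp: S_def)
      fix T assume "T \<in> range (\<lambda>n. S - F n)"
      then obtain n where T: "T = S - F n" by auto
      show "openin (top_of_set S) T \<and> S \<subseteq> closure T"
        using * closed_F[of n] unfolding T
        by (auto intro!: openin_diff closed_subset simp: F_def)
    qed
    moreover have "\<Inter>(range (\<lambda>n. S - F n)) = {}"
      using cover by blast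
    ultimately have "S \<subseteq> {}"
      by (simp only: closure_empty)
    then show False
      using \<open>\<alpha> < \<beta>\<close> by (simp add: S_def)
  qed
  then obtain n x where x: "x \<in> S" "x \<notin> closure (S - F n)"
    by blast
  then obtain e where e: "e > 0" "S \<inter> ball x e \<subseteq> F n"
    unfolding closure_approachable by (fastforce simp: dist_commute)
  obtain p q where pq: "p < q" "{p..q} \<subseteq> {\<alpha>..\<beta>} \<inter> ball x e"
    using nondegenerate_subinterval_near[OF \<open>\<alpha> < \<beta>\<close> _ \<open>e > 0\<close>] x(1) unfolding S_def by blast
  have "{p..q} \<subseteq> F n"
    using pq(2) e(2) unfolding S_def by blast
  then have "norm (f k t) \<le> real n" if "t \<in> {p..q}" for k t
    using that by (auto simp: F_def)
  then show thesis
    using pq that by blast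
qed

section \<open>Arcs of the unit circle\<close>

lemma cos_less_cos_if_far:
  assumes "0 < d" "d < x" "x < 2 * pi - d"
  shows "cos x < cos d"
proof (cases "x \<le> pi")
  case True
  then show ?thesis using assms by (intro cos_monotone_0_pi) auto
next
  case False
  then have "cos (2 * pi - x) < cos d"
    using assms by (intro cos_monotone_0_pi) auto
  then show ?thesis
    by (simp add: cos_diff)
qed

lemma connected_subset_circle_arc:
  assumes "connected J" "J \<subseteq> unit_circle" "cis s \<in> J" "cis t \<in> J" "s < t" "t < s + 2 * pi"
  shows "cis ` {s..t} \<subseteq> J \<or> cis ` {t..s + 2 * pi} \<subseteq> J"
proof (rule ccontr)
  assume "\<not> ?thesis"
  then obtain u v where uv: "u \<in> {s..t}" "cis u \<notin> J" "v \<in> {t..s + 2 * pi}" "cis v \<notin> J"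
    by blast
  have "cis (s + 2 * pi) = cis s"
    by (simp add: cis_mult[symmetric])
  then have "u \<noteq> s" "u \<noteq> t" "v \<noteq> t" "v \<noteq> s + 2 * pi"
    using uv assms(3,4) by metis+
  then have less: "s < u" "u < t" "t < v" "v < s + 2 * pi"
    using uv by auto
  define m d where "m = (u + v) / 2" and "d = (v - u) / 2"
  have d: "0 < d" "d < pi"
    using less by (auto simp: d_def)
  txt \<open>The chord through \<open>cis u\<close> and \<open>cis v\<close> is the line \<open>f = cos d\<close>, and it separates \<open>cis s\<close> from \<open>cis t\<close>.\<close>
  define f where "f z = Re (z * cis (- m))" for z
  have f_cis: "f (cis x) = cos (x - m)" for x
    by (simp add: f_def cis_mult)
  have "connected (f ` J)"
    unfolding f_def by (intro connected_continuous_image assms continuous_intros)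
  moreover have "f (cis s) < cos d"
  proof -
    have "cos (m - s) < cos d"
      using less d by (intro cos_less_cos_if_far) (auto simp: m_def d_def field_simps)
    then show ?thesis
      by (metis f_cis cos_minus minus_diff_eq)
  qed
  moreover have "cos d < f (cis t)"
  proof -
    have "cos d < cos \<bar>t - m\<bar>"
      using less d by (intro cos_monotone_0_pi) (auto simp: m_def d_def abs_if field_simps)
    then show ?thesis
      by (simp add: f_cis)
  qed
  ultimately have "cos d \<in> f ` J"
    using assms(3,4) by (meson connectedD_interval imageI less_imp_le)
  then obtain z where z: "z \<in> J" "f z = cos d"
    by force
  \<comment> \<open>A unit vector with real part \<open>cos d\<close> is \<open>cis d\<close> or
    \<open>cis (- d)\<close>. Hence the line meets the circle only at \<open>cis u\<close> and
    \<open>cis v\<close>, both outside \<open>J\<close>.\<close>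
  have "cmod (z * cis (- m)) = 1"
    using z(1) assms(2) by (auto simp: norm_mult)
  then have "(cos d)\<^sup>2 + (Im (z * cis (- m)))\<^sup>2 = 1"
    using z(2) cmod_power2[of "z * cis (- m)"] by (simp add: f_def)
  then have "(Im (z * cis (- m)))\<^sup>2 = (sin d)\<^sup>2"
    by (simp add: sin_squared_eq)
  then have "z * cis (- m) = cis d \<or> z * cis (- m) = cis (- d)"
    using z(2) by (auto simp: f_def complex_eq_iff power2_eq_iff)
  moreover have "z = z * cis (- m) * cis m"
    by (simp add: cis_mult mult.assoc)
  ultimately have "z = cis (d + m) \<or> z = cis (- d + m)"
    by (metis cis_mult)
  moreover have "d + m = v" "- d + m = u"
    by (auto simp: d_def m_def field_simps)
  ultimately show False
    using z(1) uv by auto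
qed

lemma arc_length_singleton: "arc_length {z} = 0"
proof -
  have "{t \<in> {0..<2 * pi}. cis t = z} \<subseteq> {Arg2pi z}"
    using Arg2pi_unique[of 1] by (auto simp: cis_conv_exp)
  then have "finite {t \<in> {0..<2 * pi}. cis t = z}"
    using finite_subset by blast
  then show ?thesis
    unfolding arc_length_def by (simp add: measure_def emeasure_lborel_countable countable_finite)
qed

text \<open>Positive arc length provides a second point \<open>y\<close> of \<open>J\<close>. One of
  the two arcs joining \<open>z\<close> to \<open>y\<close> lies in \<open>J\<close>, and by
  continuity of \<open>cis\<close> it can be shortened near its end \<open>z\<close>.\<close>

lemma circle_interval_arc_near:
  assumes "circle_interval J" "z \<in> J" "e > 0"
  obtains \<alpha> \<beta> where "\<alpha> < \<beta>" "cis ` {\<alpha>..\<beta>} \<subseteq> J \<inter> ball z e"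
proof -
  have J: "connected J" "J \<subseteq> unit_circle" "arc_length J > 0"
    using assms(1) by (auto simp: circle_interval_def)
  then have "J \<noteq> {z}"
    using arc_length_singleton[of z] by auto
  then obtain y where y: "y \<in> J" "y \<noteq> z"
    using \<open>z \<in> J\<close> by blast
  have cis_Arg': "cis (Arg x) = x" if "x \<in> J" for x
    using J(2) that cis_Arg[of x] by (force simp: sgn_div_norm)
  define s where "s = Arg z"
  \<comment> \<open>The angle of \<open>y\<close> is taken in the full turn that starts at
    \<open>s\<close>, so that \<open>s < t < s + 2 * pi\<close>.\<close>
  define t where "t = (if Arg y \<le> Arg z then Arg y + 2 * pi else Arg y)"
  have st: "cis s = z" "cis t = y"
    using cis_Arg'[of z] cis_Arg'[of y] y \<open>z \<in> J\<close> by (auto simp: s_def t_def cis_mult[symmetric])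
  have "Arg y \<noteq> Arg z"
    using cis_Arg'[of z] cis_Arg'[of y] y \<open>z \<in> J\<close> by metis
  then have less: "s < t" "t < s + 2 * pi"
    using Arg_bounded[of y] Arg_bounded[of z] by (auto simp: s_def t_def)
  have "cis (s + 2 * pi) = z"
    using st by (simp add: cis_mult[symmetric])
  moreover have "cis ` {s..t} \<subseteq> J \<or> cis ` {t..s + 2 * pi} \<subseteq> J"
    using connected_subset_circle_arc[OF J(1,2) _ _ less] st y(1) \<open>z \<in> J\<close> by auto
  \<comment> \<open>The angle \<open>\<tau>\<close> of \<open>z\<close> is the left end
    \<open>s\<close> of the first arc or the right end \<open>s + 2 * pi\<close> of the
    second.\<close>
  ultimately obtain \<alpha> \<beta> \<tau> where \<tau>: "\<alpha> < \<beta>" "\<tau> \<in> {\<alpha>..\<beta>}" "cis \<tau> = z" "cis ` {\<alpha>..\<beta>} \<subseteq> J"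
    using less st(1) by (metis atLeastAtMost_iff less_imp_le order_refl)
  have "continuous_on UNIV (\<lambda>x. cis x)"
    by (intro continuous_intros)
  then obtain \<eta> where \<eta>: "\<eta> > 0" "\<And>x. dist x \<tau> < \<eta> \<Longrightarrow> dist (cis x) z < e"
    using \<open>e > 0\<close> \<tau>(3) unfolding continuous_on_iff by blast
  obtain p q where "p < q" "{p..q} \<subseteq> {\<alpha>..\<beta>} \<inter> ball \<tau> \<eta>"
    using nondegenerate_subinterval_near[OF \<tau>(1,2) \<eta>(1)] .
  then show thesis
    using \<tau>(4) \<eta>(2) by (intro that[of p q]) (auto simp: dist_commute subset_iff)
qed

lemma circle_interval_unit_circle: "circle_interval unit_circle"
proof -
  have "{t \<in> {0..<2 * pi}. cis t \<in> unit_circle} = {0..<2 * pi}"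
    by auto
  then have "arc_length unit_circle = 2 * pi"
    unfolding arc_length_def by simp
  then show ?thesis
    by (simp add: circle_interval_def connected_sphere)
qed

section \<open>Integration of symmetric partial sums\<close>

text \<open>Pairing the terms at \<open>k\<close> and \<open>- k\<close> turns the symmetric sums
  into partial sums of a series over the naturals, eventually dominated by
  \<open>2 * r\<close>.\<close>

lemma convergent_symmetric_sum:
  fixes b :: "int \<Rightarrow> 'a :: banach"
  assumes "summable r" "\<And>k. n1 \<le> nat \<bar>k\<bar> \<Longrightarrow> norm (b k) \<le> r (nat \<bar>k\<bar>)"
  shows "convergent (\<lambda>m. \<Sum>k = - int m..int m. b k)"
proof -
  have eq: "(\<Sum>k = - int m..int m. b k) = b 0 + (\<Sum>j<m. b (int (Suc j)) + b (- int (Suc j)))" for m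
  proof (induction m)
    case (Suc m)
    have "{- int (Suc m)..int (Suc m)} = insert (int (Suc m)) (insert (- int (Suc m)) {- int m..int m})"
      by auto
    then show ?case
      using Suc by (simp add: add_ac)
  qed simp
  have "summable (\<lambda>j. 2 * r (Suc j))"
    using assms(1) by (intro summable_mult) (simp add: summable_Suc_iff)
  then have "summable (\<lambda>j. b (int (Suc j)) + b (- int (Suc j)))"
  proof (rule summable_comparison_test'[where N=n1])
    fix j assume "n1 \<le> j"
    then have "norm (b (int (Suc j))) \<le> r (Suc j)" "norm (b (- int (Suc j))) \<le> r (Suc j)"
      using assms(2)[of "int (Suc j)"] assms(2)[of "- int (Suc j)"]
      by (simp_all only: abs_minus_cancel abs_of_nat nat_int le_SucI)
    then show "norm (b (int (Suc j)) + b (- int (Suc j))) \<le> 2 * r (Suc j)"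
      by (intro norm_triangle_le) simp
  qed
  then show ?thesis
    unfolding eq by (intro convergent_add convergent_const) (simp add: summable_iff_convergent)
qed

lemma continuous_on_trig_partial_sum_cis: "continuous_on S (\<lambda>t. trig_partial_sum a m (cis t))"
  unfolding trig_partial_sum_def
  by (intro continuous_intros) auto

text \<open>The order of quantifiers is the point: \<open>L\<close> is fixed before the subsequence
  \<open>m\<close> and its limit \<open>g\<close>, so any two boundedly attained limits have the
  same integral. It is the limit of the integrals of the full sequence of partial sums, and every
  subsequence inherits it.\<close>

lemma integral_limit_of_trig_partial_sums:
  fixes a :: "int \<Rightarrow> complex"
  assumes M: "real_distribution M" "AE x in M. \<bar>x\<bar> \<le> \<epsilon>"
    and r: "summable r" "\<And>k. n1 \<le> nat \<bar>k\<bar> \<Longrightarrow> cmod (a k) * cmod (char M (of_int k)) \<le> r (nat \<bar>k\<bar>)"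
  obtains L where "\<And>m g B. strict_mono m \<Longrightarrow> continuous_on {\<tau>-\<epsilon>..\<tau>+\<epsilon>} g
    \<Longrightarrow> (\<And>t. t \<in> {\<tau>-\<epsilon>..\<tau>+\<epsilon>} \<Longrightarrow> (\<lambda>k. trig_partial_sum a (m k) (cis t)) \<longlonglongrightarrow> g t)
    \<Longrightarrow> (\<And>k t. t \<in> {\<tau>-\<epsilon>..\<tau>+\<epsilon>} \<Longrightarrow> cmod (trig_partial_sum a (m k) (cis t)) \<le> B)
    \<Longrightarrow> has_bochner_integral M (\<lambda>x. indicator {-\<epsilon>..\<epsilon>} x *\<^sub>R g (\<tau> + x)) L"
proof -
  interpret real_distribution M by fact
  \<comment> \<open>\<open>b k\<close> is the integral of the \<open>k\<close>-th term of the series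
    at \<open>cis (\<tau> + x)\<close> with respect to \<open>M\<close>.\<close>
  define b where "b k = a k * cis (of_int k * \<tau>) * char M (of_int k)" for k :: int
  have "convergent (\<lambda>m. \<Sum>k = - int m..int m. b k)"
    by (rule convergent_symmetric_sum[OF r(1)]) (use r(2) in \<open>simp add: b_def norm_mult\<close>)
  then obtain L where L: "(\<lambda>m. \<Sum>k = - int m..int m. b k) \<longlonglongrightarrow> L"
    by (auto simp: convergent_def)
  \<comment> \<open>Convergence and boundedness are known only on
    \<open>[-\<epsilon>, \<epsilon>]\<close>, so the sums are cut off there; as \<open>M\<close> is
    concentrated on this interval, the integrals do not change.\<close>
  define s where "s m x = indicator {-\<epsilon>..\<epsilon>} x *\<^sub>R trig_partial_sum a m (cis (\<tau> + x))" for m x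
  have [measurable]: "(\<lambda>x. trig_partial_sum a m (cis (\<tau> + x))) \<in> borel_measurable M" for m
  proof -
    have "(\<lambda>x. trig_partial_sum a m (cis (\<tau> + x))) \<in> borel_measurable borel"
      by (intro borel_measurable_continuous_onI
          continuous_on_compose2[OF continuous_on_trig_partial_sum_cis[of UNIV]] continuous_intros) auto
    then show ?thesis by simp
  qed
  have [measurable]: "s m \<in> borel_measurable M" for m
    unfolding s_def by measurable
  have integral_s: "(\<integral>x. s m x \<partial>M) = (\<Sum>k = - int m..int m. b k)" for m
  proof -
    have "(\<integral>x. s m x \<partial>M) = (\<integral>x. trig_partial_sum a m (cis (\<tau> + x)) \<partial>M)"
      by (rule integral_cong_AE) (use M(2) in \<open>auto simp: s_def indicator_def elim!: eventually_mono\<close>)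
    also have "\<dots> = (\<integral>x. (\<Sum>k = - int m..int m. a k * cis (of_int k * \<tau>) * iexp (of_int k * x)) \<partial>M)"
    proof -
      have "cis (\<tau> + x) powi k = cis (of_int k * \<tau>) * iexp (of_int k * x)" for x k
        unfolding cis_conv_exp[symmetric] by (simp add: cis_power_int cis_mult distrib_left)
      then show ?thesis
        by (simp add: trig_partial_sum_def mult.assoc)
    qed
    also have "\<dots> = (\<Sum>k = - int m..int m. a k * cis (of_int k * \<tau>) * char M (of_int k))"
      unfolding char_def
      by (subst Bochner_Integration.integral_sum) (auto intro!: integrable_mult_right integrable_const_bound[where B=1])
    finally show ?thesis
      by (simp add: b_def)
  qed
  have "has_bochner_integral M (\<lambda>x. indicator {-\<epsilon>..\<epsilon>} x *\<^sub>R g (\<tau> + x)) L"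
    if m: "strict_mono m" and g: "continuous_on {\<tau>-\<epsilon>..\<tau>+\<epsilon>} g"
      and lim: "\<And>t. t \<in> {\<tau>-\<epsilon>..\<tau>+\<epsilon>} \<Longrightarrow> (\<lambda>k. trig_partial_sum a (m k) (cis t)) \<longlonglongrightarrow> g t"
      and bound: "\<And>k t. t \<in> {\<tau>-\<epsilon>..\<tau>+\<epsilon>} \<Longrightarrow> cmod (trig_partial_sum a (m k) (cis t)) \<le> B"
    for m g B
  proof -
    let ?G = "\<lambda>x. indicator {-\<epsilon>..\<epsilon>} x *\<^sub>R g (\<tau> + x)"
    have "?G \<in> borel_measurable borel"
      by (intro borel_measurable_continuous_on_indicator continuous_on_compose2[OF g] continuous_intros) auto
    then have G[measurable]: "?G \<in> borel_measurable M"
      by simp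
    have lim': "AE x in M. (\<lambda>k. s (m k) x) \<longlonglongrightarrow> ?G x"
      unfolding s_def using lim by (auto simp: indicator_def)
    have "cmod (s (m k) x) \<le> \<bar>B\<bar>" for k x
      using bound[of "\<tau> + x" k] by (auto simp: s_def indicator_def)
    then have bound': "AE x in M. cmod (s (m k) x) \<le> \<bar>B\<bar>" for k
      by simp
    have int: "integrable M ?G"
      by (rule integrable_dominated_convergence[OF G _ _ lim' bound']) auto
    have "(\<lambda>k. \<integral>x. s (m k) x \<partial>M) \<longlonglongrightarrow> (\<integral>x. ?G x \<partial>M)"
      by (rule integral_dominated_convergence[OF G _ _ lim' bound']) auto
    moreover have "(\<lambda>k. \<integral>x. s (m k) x \<partial>M) \<longlonglongrightarrow> L"
      unfolding integral_s using LIMSEQ_subseq_LIMSEQ[OF L m] by (simp add: o_def)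
    ultimately have "(\<integral>x. ?G x \<partial>M) = L"
      by (rule LIMSEQ_unique)
    with int show ?thesis
      by (auto simp: has_bochner_integral_iff)
  qed
  then show thesis
    by (rule that)
qed

section \<open>Growth of sequences in the class\<close>

lemma class_X_minus_eventually_mono:
  assumes "c \<in> class_X_minus"
  obtains n0 where "\<And>m n. n0 \<le> m \<Longrightarrow> m \<le> n \<Longrightarrow> c m \<le> c n"
proof -
  have "eventually (\<lambda>n. real n * (c (Suc n) - c n) \<ge> 1) sequentially"
    using assms by (auto simp: class_X_minus_def filterlim_at_top)
  then obtain n0 where n0: "\<And>n. n0 \<le> n \<Longrightarrow> real n * (c (Suc n) - c n) \<ge> 1"
    by (auto simp: eventually_sequentially)
  have step: "c n \<le> c (Suc n)" if "n0 \<le> n" for n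
    using n0[OF that] mult_nonneg_nonpos[of "real n" "c (Suc n) - c n"] by fastforce
  have "c m \<le> c n" if "n0 \<le> m" "m \<le> n" for m n
    using that(2) by (induction n rule: dec_induct) (use step that(1) in \<open>auto intro: order_trans\<close>)
  then show thesis
    by (rule that)
qed

text \<open>Raabe's test: since \<open>exp x - 1 \<ge> x\<close>, the Raabe quotient is at least
  \<open>n * (c (Suc n) - c n)\<close>, which eventually exceeds 2.\<close>

lemma class_X_minus_summable_exp:
  assumes "c \<in> class_X_minus"
  shows "summable (\<lambda>n. exp (- c n))"
proof (rule raabes_test_convergence)
  have "eventually (\<lambda>n. real n * (c (Suc n) - c n) \<ge> 2) sequentially"
    using assms by (auto simp: class_X_minus_def filterlim_at_top)
  then have "eventually (\<lambda>n. ereal 2 \<le> ereal (real n * (exp (- c n) / exp (- c (Suc n)) - 1))) sequentially"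
  proof eventually_elim
    case (elim n)
    have "c (Suc n) - c n \<le> exp (c (Suc n) - c n) - 1"
      using exp_ge_add_one_self[of "c (Suc n) - c n"] by linarith
    then have "real n * (c (Suc n) - c n) \<le> real n * (exp (c (Suc n) - c n) - 1)"
      by (rule mult_left_mono) simp
    with elim show ?case
      by (simp add: exp_diff[symmetric])
  qed
  then have "ereal 2 \<le> liminf (\<lambda>n. ereal (real n * (exp (- c n) / exp (- c (Suc n)) - 1)))"
    by (rule Liminf_bounded)
  then show "1 < liminf (\<lambda>n. ereal (real n * (exp (- c n) / exp (- c (Suc n)) - 1)))"
    by (rule order.strict_trans2[rotated]) simp
qed simp

section \<open>Uniqueness of limit functions\<close>

text \<open>A pointwise convergent subsequence is pointwise bounded, so the Baire argument applies
  to it and gives the uniform bound needed for dominated convergence.\<close>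

lemma limit_functions_bounded_on_subarc:
  assumes "g \<in> limit_functions a J" "\<alpha> < \<beta>" "cis ` {\<alpha>..\<beta>} \<subseteq> J"
  obtains m p q B where "strict_mono m" "p < q" "{p..q} \<subseteq> {\<alpha>..\<beta>}"
    "\<And>t. t \<in> {\<alpha>..\<beta>} \<Longrightarrow> (\<lambda>k. trig_partial_sum a (m k) (cis t)) \<longlonglongrightarrow> g (cis t)"
    "\<And>k t. t \<in> {p..q} \<Longrightarrow> cmod (trig_partial_sum a (m k) (cis t)) \<le> B"
proof -
  obtain m :: "nat \<Rightarrow> nat" where m: "strict_mono m"
    "\<And>z. z \<in> J \<Longrightarrow> (\<lambda>k. trig_partial_sum a (m k) z) \<longlonglongrightarrow> g z"
    using assms(1) unfolding limit_functions_def by auto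
  have lim: "(\<lambda>k. trig_partial_sum a (m k) (cis t)) \<longlonglongrightarrow> g (cis t)" if "t \<in> {\<alpha>..\<beta>}" for t
    using m(2) assms(3) that by blast
  obtain p q B where "p < q" "{p..q} \<subseteq> {\<alpha>..\<beta>}"
    "\<And>k t. t \<in> {p..q} \<Longrightarrow> cmod (trig_partial_sum a (m k) (cis t)) \<le> B"
    using pointwise_bounded_imp_bounded_on_subinterval[of \<alpha> \<beta> "\<lambda>k t. trig_partial_sum a (m k) (cis t)",
        OF \<open>\<alpha> < \<beta>\<close> continuous_on_trig_partial_sum_cis convergent_imp_Bseq[OF convergentI[OF lim]]]
    by blast
  with m(1) lim show thesis
    using that by blast
qed

lemma limit_functions_unique:
  assumes c: "c \<in> class_X_minus" and a: "\<And>n. cmod (a n) \<le> exp (c (nat \<bar>n\<bar>))"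
    and J: "circle_interval J" and g: "g \<in> limit_functions a J" and h: "h \<in> limit_functions a J"
  shows "g = h"
proof (rule ccontr)
  assume "g \<noteq> h"
  have ext: "g \<in> extensional J" "h \<in> extensional J"
    and cont: "continuous_on J g" "continuous_on J h"
    using g h by (auto simp: limit_functions_def C_space_def)
  obtain z where z: "z \<in> J" "g z \<noteq> h z"
    using \<open>g \<noteq> h\<close> extensionalityI[OF ext] by blast
  define D where "D = g z - h z"
  have "cmod D > 0"
    using z by (simp add: D_def)
  have "continuous_on J (\<lambda>y. g y - h y)"
    by (intro continuous_intros cont)
  \<comment> \<open>With tolerance \<open>cmod D / 2\<close>, the average of \<open>g - h\<close>
    under a probability measure on the arc stays within \<open>cmod D / 2\<close> of
    \<open>D\<close>, hence cannot vanish.\<close>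
  then obtain e where e: "e > 0" "\<And>y. y \<in> J \<Longrightarrow> dist y z < e \<Longrightarrow> dist (g y - h y) (g z - h z) < cmod D / 2"
    using z(1) \<open>cmod D > 0\<close> unfolding continuous_on_iff by (metis half_gt_zero)
  obtain \<alpha> \<beta> where \<alpha>\<beta>: "\<alpha> < \<beta>" "cis ` {\<alpha>..\<beta>} \<subseteq> J \<inter> ball z e"
    using circle_interval_arc_near[OF J z(1) e(1)] .
  obtain m p1 q1 B where m: "strict_mono m" "p1 < q1" "{p1..q1} \<subseteq> {\<alpha>..\<beta>}"
    "\<And>t. t \<in> {\<alpha>..\<beta>} \<Longrightarrow> (\<lambda>k. trig_partial_sum a (m k) (cis t)) \<longlonglongrightarrow> g (cis t)"
    "\<And>k t. t \<in> {p1..q1} \<Longrightarrow> cmod (trig_partial_sum a (m k) (cis t)) \<le> B"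
    using limit_functions_bounded_on_subarc[OF g \<alpha>\<beta>(1)] \<alpha>\<beta>(2) by blast
  have sub1: "cis ` {p1..q1} \<subseteq> J"
    using \<alpha>\<beta>(2) m(3) by blast
  \<comment> \<open>The second Baire step is carried out inside the first interval, so that both
    uniform bounds hold on \<open>{p..q}\<close>.\<close>
  obtain n p q B' where n: "strict_mono n" "p < q" "{p..q} \<subseteq> {p1..q1}"
    "\<And>t. t \<in> {p1..q1} \<Longrightarrow> (\<lambda>k. trig_partial_sum a (n k) (cis t)) \<longlonglongrightarrow> h (cis t)"
    "\<And>k t. t \<in> {p..q} \<Longrightarrow> cmod (trig_partial_sum a (n k) (cis t)) \<le> B'"
    using limit_functions_bounded_on_subarc[OF h m(2) sub1] by blast
  define \<tau> \<epsilon> where "\<tau> = (p + q) / 2" and "\<epsilon> = (q - p) / 2"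
  have pq: "{\<tau> - \<epsilon>..\<tau> + \<epsilon>} = {p..q}" and "\<epsilon> > 0"
    using n(2) by (auto simp: \<tau>_def \<epsilon>_def field_simps)
  obtain n0 where "\<And>m n. n0 \<le> m \<Longrightarrow> m \<le> n \<Longrightarrow> c m \<le> c n"
    using class_X_minus_eventually_mono[OF c] by blast
  then have mono: "\<And>m n. n0 \<le> m \<Longrightarrow> m \<le> n \<Longrightarrow> 2 * c m \<le> 2 * c n"
    by simp
  have "summable (\<lambda>n. 2 * (c n / ((real n)\<^sup>2 + 1)))"
    using c by (intro summable_mult) (simp add: class_X_minus_def)
  then have summ: "summable (\<lambda>n. 2 * c n / ((real n)\<^sup>2 + 1))"
    by simp
  have nonneg: "0 \<le> 2 * c n" for n
    using c by (simp add: class_X_minus_def less_imp_le)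
  \<comment> \<open>The decay rate is \<open>2 * c\<close>: one copy of \<open>c\<close> cancels the
    growth of \<open>a\<close>, the other leaves the summable majorant
    \<open>exp (- c n)\<close>.\<close>
  obtain M n1 where M: "real_distribution M" "AE x in M. \<bar>x\<bar> \<le> \<epsilon>"
    "\<And>n t. n1 \<le> n \<Longrightarrow> \<bar>t\<bar> = real n \<Longrightarrow> cmod (char M t) \<le> exp (- (2 * c n))"
    using localized_distribution_char_decay[OF nonneg mono summ \<open>\<epsilon> > 0\<close>] by blast
  interpret real_distribution M by fact
  have r: "cmod (a k) * cmod (char M (of_int k)) \<le> exp (- c (nat \<bar>k\<bar>))" if "n1 \<le> nat \<bar>k\<bar>" for k :: int
  proof -
    have "cmod (a k) * cmod (char M (of_int k)) \<le> exp (c (nat \<bar>k\<bar>)) * exp (- (2 * c (nat \<bar>k\<bar>)))"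
      by (intro mult_mono a M(3)) (use that in auto)
    then show ?thesis
      by (simp add: exp_add[symmetric])
  qed
  obtain L where L: "\<And>m g B. strict_mono m \<Longrightarrow> continuous_on {p..q} g
    \<Longrightarrow> (\<And>t. t \<in> {p..q} \<Longrightarrow> (\<lambda>k. trig_partial_sum a (m k) (cis t)) \<longlonglongrightarrow> g t)
    \<Longrightarrow> (\<And>k t. t \<in> {p..q} \<Longrightarrow> cmod (trig_partial_sum a (m k) (cis t)) \<le> B)
    \<Longrightarrow> has_bochner_integral M (\<lambda>x. indicator {-\<epsilon>..\<epsilon>} x *\<^sub>R g (\<tau> + x)) L"
    using integral_limit_of_trig_partial_sums[OF M(1,2) class_X_minus_summable_exp[OF c] r, where \<tau> = \<tau>]
    unfolding pq by blast
  have sub: "cis ` {p..q} \<subseteq> J \<inter> ball z e"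
    using \<alpha>\<beta>(2) m(3) n(3) by blast
  have cont': "continuous_on {p..q} (\<lambda>t. g (cis t))" "continuous_on {p..q} (\<lambda>t. h (cis t))"
    using sub by (auto intro!: continuous_on_compose2[OF cont(1)] continuous_on_compose2[OF cont(2)] continuous_intros)
  have "has_bochner_integral M (\<lambda>x. indicator {-\<epsilon>..\<epsilon>} x *\<^sub>R g (cis (\<tau> + x))) L"
    using m n(3) by (intro L[OF m(1) cont'(1)]) blast+
  moreover have "has_bochner_integral M (\<lambda>x. indicator {-\<epsilon>..\<epsilon>} x *\<^sub>R h (cis (\<tau> + x))) L"
    using n by (intro L[OF n(1) cont'(2)]) blast+
  \<comment> \<open>Since \<open>g\<close> and \<open>h\<close> have the same integral
    \<open>L\<close>, the integral of \<open>I\<close> is \<open>- D\<close>, although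
    \<open>cmod (I x) \<le> cmod D / 2\<close> almost everywhere.\<close>
  moreover define I where "I x = indicator {-\<epsilon>..\<epsilon>} x *\<^sub>R g (cis (\<tau> + x))
      - indicator {-\<epsilon>..\<epsilon>} x *\<^sub>R h (cis (\<tau> + x)) - D" for x
  moreover have "has_bochner_integral M (\<lambda>x. D) D"
    using prob_space by (simp add: has_bochner_integral_iff)
  ultimately have I: "has_bochner_integral M I (L - L - D)"
    unfolding I_def by (intro has_bochner_integral_diff)
  then have "cmod D = cmod (\<integral>x. I x \<partial>M)"
    by (simp add: has_bochner_integral_iff)
  also have "\<dots> \<le> (\<integral>x. cmod (I x) \<partial>M)"
    by (rule integral_norm_bound)
  also have "\<dots> \<le> (\<integral>x. cmod D / 2 \<partial>M)"
  proof (rule integral_mono_AE)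
    show "AE x in M. cmod (I x) \<le> cmod D / 2"
      using M(2)
    proof eventually_elim
      case (elim x)
      then have "\<tau> + x \<in> {\<tau> - \<epsilon>..\<tau> + \<epsilon>}"
        by auto
      then have "cis (\<tau> + x) \<in> J \<inter> ball z e"
        unfolding pq using sub by blast
      then have "dist (g (cis (\<tau> + x)) - h (cis (\<tau> + x))) D < cmod D / 2"
        using e(2)[of "cis (\<tau> + x)"] by (simp add: D_def dist_commute)
      then show ?case
        using elim by (simp add: I_def dist_norm indicator_def abs_le_iff)
    qed
  qed (use I in \<open>auto simp: has_bochner_integral_iff\<close>)
  also have "\<dots> = cmod D / 2"
    using prob_space by simp
  finally show False
    using \<open>cmod D > 0\<close> by simp
qed

theorem theorem1p6:
  fixes a :: "int \<Rightarrow> complex"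
  assumes "\<exists>c \<in> class_X_minus. \<forall>n. cmod (a n) \<le> exp (c (nat \<bar>n\<bar>))"
  shows "(\<forall>J. circle_interval J \<longrightarrow> (\<exists>\<^sub>\<le>\<^sub>1 g. g \<in> limit_functions a J))
         \<and> \<not> universal_in_Cp a"
proof
  show unique: "\<forall>J. circle_interval J \<longrightarrow> (\<exists>\<^sub>\<le>\<^sub>1 g. g \<in> limit_functions a J)"
    using assms limit_functions_unique[of _ a] unfolding Uniq_def by blast
  show "\<not> universal_in_Cp a"
  proof
    assume "universal_in_Cp a"
    then have "limit_functions a unit_circle = C_space unit_circle"
      by (simp only: universal_in_Cp_iff)
    \<comment> \<open>Universality would make the constants 0 and 1 both limit functions on the
      whole circle; they are restricted because elements of \<open>C_space\<close> are
      extensional.\<close>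
    moreover have "restrict (\<lambda>_. w) unit_circle \<in> C_space unit_circle" for w :: complex
      unfolding C_space_def
      by (intro CollectI conjI restrict_extensional continuous_on_eq[OF continuous_on_const[of _ w]]) simp
    ultimately have "restrict (\<lambda>_. 0) unit_circle = restrict (\<lambda>_. 1 :: complex) unit_circle"
      using unique circle_interval_unit_circle unfolding Uniq_def by blast
    from fun_cong[OF this, of 1] show False
      by simp
  qed
qed

end
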